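(* Let $G$ be a totally disconnected, locally compact group and suppose that $G$ has a lattice $H$ such that the cyclic subgroup $\langle h\rangle$ is finite for every $h\in H$. Then $G$ is anisotropic, and for every $x\in G$ the cyclic subgroup $\langle x\rangle$ is pre-compact (that is, has compact closure in $G$).
   Context: Let $G$ be a (Hausdorff) totally disconnected, locally compact group with identity $e$. A lattice in $G$ is a closed subgroup $H$ that is discrete in the subspace topology and has finite co-volume, meaning that the coset space $G/H$ supports a nonzero finite $G$-invariant Radon measure. The contraction subgroup for $x\in G$ is $\mathsf{con}(x) := \{g\in G \mid x^n g x^{-n}\to e \text{ as } n\to\infty\}$. The group $G$ is anisotropic if $\mathsf{con}(x)=\{e\}$ for every $x\in G$. *)

theory Defs
  imports
    "HOL-Analysis.Analysis"
    "HOL-Algebra.Left_Coset"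
    "HOL-Algebra.Generated_Groups"
begin

section \<open>Totally disconnected, locally compact groups\<close>

locale topological_group = group G for G (structure) +
  fixes T :: "'a topology"
  assumes topspace_eq_carrier: "topspace T = carrier G"
    and continuous_mult: "continuous_map (prod_topology T T) T (\<lambda>(x, y). x \<otimes> y)"
    and continuous_inv: "continuous_map T T (\<lambda>x. inv x)"

definition totally_disconnected_space :: "'a topology \<Rightarrow> bool" where
  "totally_disconnected_space X \<longleftrightarrow>
     (\<forall>x \<in> topspace X. connected_component_of_set X x = {x})"

locale tdlc_group = topological_group +
  assumes Hausdorff: "Hausdorff_space T"
    and totally_disconnected: "totally_disconnected_space T"
    and locally_compact: "locally_compact_space T"


section \<open>Radon measures on topological spaces\<close>

definition borel_sets_of :: "'a topology \<Rightarrow> 'a set set" where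
  "borel_sets_of X = sigma_sets (topspace X) {U. openin X U}"

text \<open>
  Outer regular on Borel sets and inner regular on open sets. For finite measures on
  a Hausdorff space this is the same as inner regularity (by compact sets) on all Borel sets,
  so the competing conventions agree wherever the notion is used below.
\<close>

definition radon_measure :: "'a topology \<Rightarrow> 'a measure \<Rightarrow> bool" where
  "radon_measure X M \<longleftrightarrow>
     space M = topspace X \<and>
     sets M = borel_sets_of X \<and>
     (\<forall>K. compactin X K \<longrightarrow> emeasure M K < \<infinity>) \<and>
     (\<forall>A \<in> sets M. emeasure M A = (INF U \<in> {U. openin X U \<and> A \<subseteq> U}. emeasure M U)) \<and>
     (\<forall>U. openin X U \<longrightarrow>
        emeasure M U = (SUP K \<in> {K. compactin X K \<and> K \<subseteq> U}. emeasure M K))"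


section \<open>Coset spaces and lattices\<close>

definition quotient_topology :: "'a topology \<Rightarrow> ('a \<Rightarrow> 'b) \<Rightarrow> 'b topology" where
  "quotient_topology X f =
     topology (\<lambda>U. U \<subseteq> f ` topspace X \<and> openin X {x \<in> topspace X. f x \<in> U})"

lemma openin_quotient_topology:
  "openin (quotient_topology X f) U \<longleftrightarrow>
     U \<subseteq> f ` topspace X \<and> openin X {x \<in> topspace X. f x \<in> U}"
proof -
  have "istopology (\<lambda>U. U \<subseteq> f ` topspace X \<and> openin X {x \<in> topspace X. f x \<in> U})"
    unfolding istopology_def
  proof (intro conjI allI impI)
    fix S T
    assume S: "S \<subseteq> f ` topspace X \<and> openin X {x \<in> topspace X. f x \<in> S}"
      and T: "T \<subseteq> f ` topspace X \<and> openin X {x \<in> topspace X. f x \<in> T}"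
    have "{x \<in> topspace X. f x \<in> S \<inter> T} =
        {x \<in> topspace X. f x \<in> S} \<inter> {x \<in> topspace X. f x \<in> T}"
      by blast
    then show "openin X {x \<in> topspace X. f x \<in> S \<inter> T}"
      using S T by (simp add: openin_Int)
    show "S \<inter> T \<subseteq> f ` topspace X"
      using S by blast
  next
    fix \<K>
    assume K: "\<forall>K\<in>\<K>. K \<subseteq> f ` topspace X \<and> openin X {x \<in> topspace X. f x \<in> K}"
    have "{x \<in> topspace X. f x \<in> \<Union>\<K>} = (\<Union>K\<in>\<K>. {x \<in> topspace X. f x \<in> K})"
      by blast
    moreover have "openin X (\<Union>K\<in>\<K>. {x \<in> topspace X. f x \<in> K})"
      using K by (intro openin_Union) auto
    ultimately show "openin X {x \<in> topspace X. f x \<in> \<Union>\<K>}"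
      by simp
    show "\<Union>\<K> \<subseteq> f ` topspace X"
      using K by blast
  qed
  then show ?thesis
    by (simp add: quotient_topology_def)
qed

lemma topspace_quotient_topology: "topspace (quotient_topology X f) = f ` topspace X"
proof
  show "topspace (quotient_topology X f) \<subseteq> f ` topspace X"
    by (auto simp: topspace_def openin_quotient_topology)
  have "{x \<in> topspace X. f x \<in> f ` topspace X} = topspace X"
    by blast
  then have "openin (quotient_topology X f) (f ` topspace X)"
    by (simp add: openin_quotient_topology)
  then show "f ` topspace X \<subseteq> topspace (quotient_topology X f)"
    by (rule openin_subset)
qed

lemma quotient_map_quotient_topology: "quotient_map X (quotient_topology X f) f"
  by (auto simp: quotient_map_def topspace_quotient_topology openin_quotient_topology)

definition coset_space ::
    "('a, 'm) monoid_scheme \<Rightarrow> 'a topology \<Rightarrow> 'a set \<Rightarrow> 'a set topology" where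
  "coset_space G T H = quotient_topology T (\<lambda>x. x <#\<^bsub>G\<^esub> H)"

lemma (in topological_group) topspace_coset_space:
  "topspace (coset_space G T H) = lcosets H"
  by (auto simp: coset_space_def topspace_quotient_topology topspace_eq_carrier LCOSETS_def)

definition translation_invariant ::
    "('a, 'm) monoid_scheme \<Rightarrow> 'a set measure \<Rightarrow> bool" where
  "translation_invariant G M \<longleftrightarrow>
     (\<forall>g \<in> carrier G. \<forall>A \<in> sets M. emeasure M ((\<lambda>C. g <#\<^bsub>G\<^esub> C) ` A) = emeasure M A)"

definition finite_covolume ::
    "('a, 'm) monoid_scheme \<Rightarrow> 'a topology \<Rightarrow> 'a set \<Rightarrow> bool" where
  "finite_covolume G T H \<longleftrightarrow>
     (\<exists>M. radon_measure (coset_space G T H) M \<and> translation_invariant G M \<and>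
          emeasure M (space M) \<noteq> 0 \<and> emeasure M (space M) < \<infinity>)"

definition lattice_subgroup ::
    "('a, 'm) monoid_scheme \<Rightarrow> 'a topology \<Rightarrow> 'a set \<Rightarrow> bool" where
  "lattice_subgroup G T H \<longleftrightarrow>
     subgroup H G \<and> closedin T H \<and> subtopology T H = discrete_topology H \<and>
     finite_covolume G T H"


section \<open>Contraction subgroups and anisotropy\<close>

definition con :: "('a, 'm) monoid_scheme \<Rightarrow> 'a topology \<Rightarrow> 'a \<Rightarrow> 'a set" where
  "con G T x =
     {g \<in> carrier G.
        limitin T (\<lambda>n::nat. x [^]\<^bsub>G\<^esub> n \<otimes>\<^bsub>G\<^esub> g \<otimes>\<^bsub>G\<^esub> x [^]\<^bsub>G\<^esub> (- int n)) \<one>\<^bsub>G\<^esub> sequentially}"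

definition anisotropic :: "('a, 'm) monoid_scheme \<Rightarrow> 'a topology \<Rightarrow> bool" where
  "anisotropic G T \<longleftrightarrow> (\<forall>x \<in> carrier G. con G T x = {\<one>\<^bsub>G\<^esub>})"

definition precompact_in :: "'a topology \<Rightarrow> 'a set \<Rightarrow> bool" where
  "precompact_in X S \<longleftrightarrow> compactin X (X closure_of S)"

end

theory Submission
  imports Defs "HOL-Algebra.Multiplicative_Group"
begin

text \<open>
  For every $x$ there is a compact open subgroup $U$, tidy above for $x$, with
  $(U x^m U)(U x^n U) \subseteq U x^{m+n} U$ for all $m, n \ge 0$. Poincare recurrence on the
  finite measure space $G/H$, applied to the image of $U$, gives some $n \ge 1$ for which
  $U x^n U$ meets $H$ and so contains an element of finite order $k$; then
  $1 \in U x^{kn} U$, that is, $x^{kn} \in U$. Hence $\langle x\rangle$ lies in finitely many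
  translates of $U$. If moreover $x^n g x^{-n} \to 1$, then $1$ belongs to the compact, hence
  closed, set of conjugates of $g$ by the closure of $\langle x\rangle$, so $g = 1$.
\<close>

section \<open>Invariant measures on the coset space and Poincare recurrence\<close>

context topological_group
begin

lemma continuous_map_group_mult:
  assumes "continuous_map X T f" "continuous_map X T g"
  shows "continuous_map X T (\<lambda>x. f x \<otimes> g x)"
proof -
  have "continuous_map X (prod_topology T T) (\<lambda>x. (f x, g x))"
    using assms by (simp add: continuous_map_paired)
  from continuous_map_compose[OF this continuous_mult] show ?thesis
    by (simp add: o_def)
qed

text \<open>One two-sided form serves left translations, right translations and conjugations. A
  one-sided translation takes the unit as its other factor, which explains the extra
  \<open>\<one>\<close> in later sets.\<close>

lemma continuous_map_translations:
  assumes "a \<in> carrier G" "b \<in> carrier G"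
  shows "continuous_map T T (\<lambda>g. a \<otimes> g \<otimes> b)"
  using assms by (intro continuous_map_group_mult) (auto simp: topspace_eq_carrier)

text \<open>The projection is open because the preimage of the image of \<open>W\<close> is the
  product set \<open>W H\<close>, a union of right translates of \<open>W\<close>.\<close>

lemma openin_coset_image:
  assumes H: "subgroup H G" and W: "openin T W"
  shows "openin (coset_space G T H) ((\<lambda>u. u <#\<^bsub>G\<^esub> H) ` W)"
proof -
  have Wc: "W \<subseteq> carrier G"
    using W openin_subset topspace_eq_carrier by blast
  have Hc: "H \<subseteq> carrier G"
    using H subgroup.subset by blast
  have "{y \<in> carrier G. y <#\<^bsub>G\<^esub> H \<in> (\<lambda>u. u <#\<^bsub>G\<^esub> H) ` W} = (\<Union>h\<in>H. {y \<in> topspace T. \<one> \<otimes> y \<otimes> h \<in> W})"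
  proof (intro equalityI subsetI)
    fix y assume "y \<in> {y \<in> carrier G. y <#\<^bsub>G\<^esub> H \<in> (\<lambda>u. u <#\<^bsub>G\<^esub> H) ` W}"
    then obtain u where y: "y \<in> carrier G" and u: "u \<in> W" "y <#\<^bsub>G\<^esub> H = u <#\<^bsub>G\<^esub> H" by auto
    then have "u \<in> y <#\<^bsub>G\<^esub> H"
      using lcos_self[OF _ H, of u] Wc by auto
    then obtain h where "h \<in> H" "u = y \<otimes> h" by (auto simp: l_coset_def)
    then show "y \<in> (\<Union>h\<in>H. {y \<in> topspace T. \<one> \<otimes> y \<otimes> h \<in> W})"
      using y u by (auto simp: topspace_eq_carrier)
  next
    fix y assume "y \<in> (\<Union>h\<in>H. {y \<in> topspace T. \<one> \<otimes> y \<otimes> h \<in> W})"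
    then obtain h where y: "y \<in> carrier G" and h: "h \<in> H" "y \<otimes> h \<in> W"
      by (auto simp: topspace_eq_carrier)
    then have "y \<otimes> h \<in> y <#\<^bsub>G\<^esub> H" by (auto simp: l_coset_def)
    then have "y <#\<^bsub>G\<^esub> H = (y \<otimes> h) <#\<^bsub>G\<^esub> H"
      using l_repr_independence[OF _ y H] by blast
    then show "y \<in> {y \<in> carrier G. y <#\<^bsub>G\<^esub> H \<in> (\<lambda>u. u <#\<^bsub>G\<^esub> H) ` W}"
      using y h by auto
  qed
  moreover have "openin T {y \<in> topspace T. \<one> \<otimes> y \<otimes> h \<in> W}" if "h \<in> H" for h
    using openin_continuous_map_preimage[OF continuous_map_translations W, of "\<one>" h] that Hc by auto
  ultimately have "openin T {y \<in> carrier G. y <#\<^bsub>G\<^esub> H \<in> (\<lambda>u. u <#\<^bsub>G\<^esub> H) ` W}"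
    by (simp only:) (intro openin_Union, auto)
  then show ?thesis
    using Wc by (auto simp: coset_space_def openin_quotient_topology topspace_eq_carrier)
qed

lemma l_coset_image_translate:
  assumes "subgroup H G" "W \<subseteq> carrier G" "g \<in> carrier G"
  shows "(\<lambda>C. g <#\<^bsub>G\<^esub> C) ` (\<lambda>u. u <#\<^bsub>G\<^esub> H) ` W = (\<lambda>u. (g \<otimes> u) <#\<^bsub>G\<^esub> H) ` W"
  using assms subgroup.subset[OF assms(1)]
  by (auto simp: image_image lcos_m_assoc subset_iff)

text \<open>If the image of \<open>W\<close> were null, its translates would be null open sets
  covering the coset space. Every compact set would lie in finitely many of them and be null, and
  inner regularity on the whole space would make the total measure zero.\<close>

lemma emeasure_coset_image_pos:
  assumes H: "subgroup H G" and W: "openin T W" "W \<noteq> {}"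
    and M: "radon_measure (coset_space G T H) M" "translation_invariant G M"
      "emeasure M (space M) \<noteq> 0"
  shows "emeasure M ((\<lambda>u. u <#\<^bsub>G\<^esub> H) ` W) \<noteq> 0"
proof
  let ?X = "coset_space G T H"
  let ?A = "(\<lambda>u. u <#\<^bsub>G\<^esub> H) ` W"
  assume 0: "emeasure M ?A = 0"
  have Wc: "W \<subseteq> carrier G"
    using W openin_subset topspace_eq_carrier by blast
  have sp: "space M = topspace ?X" and sets: "sets M = borel_sets_of ?X"
    using M by (auto simp: radon_measure_def)
  have open_sets: "U \<in> sets M" if "openin ?X U" for U
    using that by (auto simp: sets borel_sets_of_def)
  \<comment> \<open>The translate is the image of \<open>g W\<close>, and \<open>g W\<close> is
    written as a preimage under left multiplication by \<open>inv g\<close>, so that openness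
    follows from continuity.\<close>
  have tr: "(\<lambda>C. g <#\<^bsub>G\<^esub> C) ` ?A = (\<lambda>u. u <#\<^bsub>G\<^esub> H) ` {y \<in> topspace T. inv g \<otimes> y \<otimes> \<one> \<in> W}"
    if g: "g \<in> carrier G" for g
  proof -
    have eq: "(\<lambda>u. g \<otimes> u) ` W = {y \<in> topspace T. inv g \<otimes> y \<otimes> \<one> \<in> W}"
    proof (intro equalityI subsetI)
      fix y assume "y \<in> {y \<in> topspace T. inv g \<otimes> y \<otimes> \<one> \<in> W}"
      then have "y \<in> carrier G" "inv g \<otimes> y \<in> W" using g by (auto simp: topspace_eq_carrier)
      moreover have "y = g \<otimes> (inv g \<otimes> y)" using calculation g by (simp flip: m_assoc)
      ultimately show "y \<in> (\<lambda>u. g \<otimes> u) ` W" by blast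
    next
      fix y assume "y \<in> (\<lambda>u. g \<otimes> u) ` W"
      then show "y \<in> {y \<in> topspace T. inv g \<otimes> y \<otimes> \<one> \<in> W}"
        using g Wc by (auto simp: topspace_eq_carrier simp flip: m_assoc)
    qed
    show ?thesis
      unfolding l_coset_image_translate[OF H Wc g] eq[symmetric] by (simp only: image_image)
  qed
  have opn: "openin ?X ((\<lambda>C. g <#\<^bsub>G\<^esub> C) ` ?A)" if g: "g \<in> carrier G" for g
    unfolding tr[OF g]
    by (intro openin_coset_image[OF H] openin_continuous_map_preimage[OF continuous_map_translations W(1)])
       (use g in auto)
  have null: "emeasure M ((\<lambda>C. g <#\<^bsub>G\<^esub> C) ` ?A) = 0" if g: "g \<in> carrier G" for g
    using M(2) g 0 open_sets[OF openin_coset_image[OF H W(1)]]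
    by (auto simp: translation_invariant_def)
  \<comment> \<open>Any point of \<open>W\<close> serves: translation by
    \<open>y \<otimes> inv w\<close> carries the coset of \<open>w\<close> to the coset of
    \<open>y\<close>.\<close>
  obtain w where w: "w \<in> W" "w \<in> carrier G" using W Wc by auto
  have cover: "topspace ?X \<subseteq> (\<Union>g\<in>carrier G. (\<lambda>C. g <#\<^bsub>G\<^esub> C) ` ?A)"
  proof
    fix C assume "C \<in> topspace ?X"
    then obtain y where y: "y \<in> carrier G" "C = y <#\<^bsub>G\<^esub> H"
      by (auto simp: topspace_coset_space LCOSETS_def)
    have "y = (y \<otimes> inv w) \<otimes> w"
      using y w by (simp add: m_assoc)
    then have C: "C \<in> (\<lambda>u. ((y \<otimes> inv w) \<otimes> u) <#\<^bsub>G\<^esub> H) ` W"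
      using y w by (intro image_eqI[of _ _ w]) auto
    have g: "y \<otimes> inv w \<in> carrier G"
      using y w by simp
    show "C \<in> (\<Union>g\<in>carrier G. (\<lambda>C. g <#\<^bsub>G\<^esub> C) ` ?A)"
      by (rule UN_I[OF g]) (simp only: l_coset_image_translate[OF H Wc g] C)
  qed
  have "emeasure M K = 0" if K: "compactin ?X K" for K
  proof -
    have "\<exists>\<F>. finite \<F> \<and> \<F> \<subseteq> (\<lambda>g. (\<lambda>C. g <#\<^bsub>G\<^esub> C) ` ?A) ` carrier G \<and> K \<subseteq> \<Union>\<F>"
      by (rule compactinD[OF K]) (use opn cover compactin_subset_topspace[OF K] in auto)
    then obtain \<F> where F: "finite \<F>" "\<F> \<subseteq> (\<lambda>g. (\<lambda>C. g <#\<^bsub>G\<^esub> C) ` ?A) ` carrier G" "K \<subseteq> \<Union>\<F>"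
      by blast
    have "(\<lambda>C. g <#\<^bsub>G\<^esub> C) ` ?A \<in> null_sets M" if "g \<in> carrier G" for g
      by (rule null_setsI[OF null[OF that] open_sets[OF opn[OF that]]])
    then have "\<F> \<subseteq> null_sets M"
      using F(2) by blast
    then have "\<Union>\<F> \<in> null_sets M"
      using F(1) by (intro null_sets.finite_Union)
    then have "emeasure M (\<Union>\<F>) = 0" "\<Union>\<F> \<in> sets M" by auto
    then show ?thesis
      using emeasure_mono[OF F(3), of M] by simp
  qed
  moreover have "emeasure M (topspace ?X) = (SUP K \<in> {K. compactin ?X K \<and> K \<subseteq> topspace ?X}. emeasure M K)"
    using M(1) by (simp add: radon_measure_def)
  ultimately have "emeasure M (topspace ?X) \<le> 0"
    by (simp only:) (rule SUP_least, auto)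
  then show False using M(3) sp by simp
qed

text \<open>The translates of the image of \<open>W\<close> by the powers of \<open>x\<close> all
  have the same positive measure inside a finite measure space, so two of them overlap. Cancelling
  \<open>x [^] i\<close> from an equality of cosets of \<open>x [^] i \<otimes> u\<close> and
  \<open>x [^] j \<otimes> v\<close> with \<open>i < j\<close> gives the element of
  \<open>H\<close>.\<close>

lemma finite_covolume_recurrence:
  assumes H: "subgroup H G" and fin: "finite_covolume G T H"
    and W: "openin T W" "W \<noteq> {}" and x: "x \<in> carrier G"
  obtains n :: nat and u v where "n > 0" "u \<in> W" "v \<in> W" "inv u \<otimes> x [^] n \<otimes> v \<in> H"
proof -
  let ?X = "coset_space G T H"
  let ?A = "(\<lambda>u. u <#\<^bsub>G\<^esub> H) ` W"
  have Wc: "W \<subseteq> carrier G"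
    using W openin_subset topspace_eq_carrier by blast
  obtain M where M: "radon_measure ?X M" "translation_invariant G M"
      "emeasure M (space M) \<noteq> 0" "emeasure M (space M) < \<infinity>"
    using fin by (auto simp: finite_covolume_def)
  interpret finite_measure M
    by (rule finite_measureI) (use M(4) in auto)
  have A: "?A \<in> sets M"
    using openin_coset_image[OF H W(1)] M(1) by (auto simp: radon_measure_def borel_sets_of_def)
  have B: "(\<lambda>C. g <#\<^bsub>G\<^esub> C) ` ?A \<in> sets M \<and> measure M ((\<lambda>C. g <#\<^bsub>G\<^esub> C) ` ?A) = measure M ?A"
    if g: "g \<in> carrier G" for g
  proof -
    have e: "emeasure M ((\<lambda>C. g <#\<^bsub>G\<^esub> C) ` ?A) = emeasure M ?A"
      using M(2) g A by (auto simp: translation_invariant_def)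
    also have "\<dots> \<noteq> 0"
      by (rule emeasure_coset_image_pos[OF H W M(1-3)])
    \<comment> \<open>\<open>emeasure\<close> is 0 outside \<open>sets M\<close>, so the nonzero
      value also proves that the translate is measurable.\<close>
    finally show ?thesis
      using e emeasure_notin_sets[of "(\<lambda>C. g <#\<^bsub>G\<^esub> C) ` ?A" M] by (auto simp: measure_def)
  qed
  define F where "F n = (\<lambda>C. x [^] n <#\<^bsub>G\<^esub> C) ` ?A" for n :: nat
  have "\<not> disjoint_family F"
  proof
    assume "disjoint_family F"
    \<comment> \<open>Countable additivity would sum one constant to a finite value, and a summable
      constant sequence is zero.\<close>
    then have "(\<lambda>i. measure M (F i)) sums measure M (\<Union>i. F i)"
      by (intro finite_measure_UNION) (use B x in \<open>auto simp: F_def[abs_def]\<close>)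
    then have "summable (\<lambda>i::nat. measure M ?A)"
      using B x by (auto simp: F_def sums_iff)
    then have "measure M ?A = 0"
      by (simp add: summable_const_iff)
    then show False
      using emeasure_coset_image_pos[OF H W M(1-3)] by (simp add: emeasure_eq_measure)
  qed
  then obtain i j where "i \<noteq> j" "F i \<inter> F j \<noteq> {}"
    by (auto simp: disjoint_family_on_def)
  then obtain i j where ij: "i < j" "F i \<inter> F j \<noteq> {}"
    by (metis Int_commute linorder_neq_iff)
  then obtain u v where uv: "u \<in> W" "v \<in> W" and eq: "(x [^] i \<otimes> u) <#\<^bsub>G\<^esub> H = (x [^] j \<otimes> v) <#\<^bsub>G\<^esub> H"
    using l_coset_image_translate[OF H Wc] x by (auto simp: F_def)
  have uvc: "u \<in> carrier G" "v \<in> carrier G" using uv Wc by auto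
  have "x [^] j \<otimes> v \<in> (x [^] i \<otimes> u) <#\<^bsub>G\<^esub> H"
    unfolding eq by (rule lcos_self) (use x uvc H in auto)
  then obtain h where h: "h \<in> H" and e: "x [^] j \<otimes> v = x [^] i \<otimes> u \<otimes> h"
    by (auto simp: l_coset_def)
  have hc: "h \<in> carrier G" using h H subgroup.subset by blast
  have "x [^] j = x [^] i \<otimes> x [^] (j - i)"
    using ij x by (simp add: nat_pow_mult)
  then have "x [^] i \<otimes> (x [^] (j - i) \<otimes> v) = x [^] i \<otimes> (u \<otimes> h)"
    using e x uvc hc by (simp add: m_assoc)
  then have "x [^] (j - i) \<otimes> v = u \<otimes> h"
    using x uvc hc by simp
  then have "inv u \<otimes> x [^] (j - i) \<otimes> v = h"
    using x uvc hc by (metis inv_closed inv_solve_left m_assoc m_closed nat_pow_closed)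
  then show thesis
    using that[of "j - i" u v] ij uv h by auto
qed

end

section \<open>Products and powers of double cosets\<close>

context group
begin

text \<open>Rewriting \<open>x \<otimes> g\<close> as \<open>u \<otimes> x \<otimes> p\<close>
  handles one factor \<open>x\<close> at a time: \<open>p\<close> travels right through
  \<open>x [^] m\<close> because conjugation by \<open>inv x\<close> keeps it in \<open>P\<close>,
  while \<open>u\<close> is left facing the remaining powers of \<open>x\<close>.\<close>

lemma double_coset_mult_subset:
  assumes U: "subgroup U G" and x: "x \<in> carrier G" and P: "P \<subseteq> U"
    and Px: "\<And>p. p \<in> P \<Longrightarrow> inv x \<otimes> p \<otimes> x \<in> P"
    and fact: "\<And>g. g \<in> U \<Longrightarrow> \<exists>u\<in>U. \<exists>p\<in>P. x \<otimes> g = u \<otimes> x \<otimes> p"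
  shows "g \<in> U \<Longrightarrow> \<exists>u\<in>U. \<exists>v\<in>U. x [^] (n::nat) \<otimes> g \<otimes> x [^] (m::nat) = u \<otimes> x [^] (n + m) \<otimes> v"
proof (induction n arbitrary: g m)
  case 0
  then show ?case
    using subgroup.one_closed[OF U] subgroup.subset[OF U] x
    by (intro bexI[of _ g] bexI[of _ "\<one>"]) auto
next
  case (Suc n)
  have Uc: "U \<subseteq> carrier G" by (rule subgroup.subset[OF U])
  have push: "\<exists>q\<in>P. p \<otimes> x [^] k = x [^] k \<otimes> q" if "p \<in> P" for p and k :: nat
    using that
  proof (induction k arbitrary: p)
    case 0
    then show ?case using P Uc x by (intro bexI[of _ p]) auto
  next
    case (Suc k)
    then obtain q where q: "q \<in> P" "p \<otimes> x [^] k = x [^] k \<otimes> q" by blast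
    have c: "p \<in> carrier G" "q \<in> carrier G" using q Suc.prems P Uc by auto
    have "p \<otimes> x [^] Suc k = (p \<otimes> x [^] k) \<otimes> x" using c x by (simp add: m_assoc)
    also have "\<dots> = x [^] k \<otimes> (q \<otimes> x)" using c x q by (simp add: m_assoc)
    also have "q \<otimes> x = x \<otimes> (inv x \<otimes> q \<otimes> x)" using c x by (simp flip: m_assoc)
    also have "x [^] k \<otimes> (x \<otimes> (inv x \<otimes> q \<otimes> x)) = x [^] Suc k \<otimes> (inv x \<otimes> q \<otimes> x)"
      using c x by (simp add: m_assoc)
    finally show ?case using Px[OF q(1)] by blast
  qed
  obtain u p where up: "u \<in> U" "p \<in> P" "x \<otimes> g = u \<otimes> x \<otimes> p" using fact Suc.prems by blast
  obtain q where q: "q \<in> P" "p \<otimes> x [^] m = x [^] m \<otimes> q" using push up by blast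
  \<comment> \<open>The factor \<open>x\<close> just passed joins the right-hand power, so the
    induction hypothesis is used at \<open>Suc m\<close> and with \<open>u\<close> in place of
    \<open>g\<close>.\<close>
  obtain u' v where u': "u' \<in> U" "v \<in> U" "x [^] n \<otimes> u \<otimes> x [^] Suc m = u' \<otimes> x [^] (n + Suc m) \<otimes> v"
    using Suc.IH[OF up(1)] by blast
  have c: "g \<in> carrier G" "u \<in> carrier G" "p \<in> carrier G" "q \<in> carrier G" "u' \<in> carrier G" "v \<in> carrier G"
    using up q u' P Uc Suc.prems by auto
  have xm: "x \<otimes> x [^] m = x [^] Suc m" using x by (metis nat_pow_Suc2)
  have "x [^] Suc n \<otimes> g \<otimes> x [^] m = x [^] n \<otimes> (x \<otimes> g) \<otimes> x [^] m"
    using c x by (simp add: m_assoc)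
  also have "\<dots> = x [^] n \<otimes> u \<otimes> (x \<otimes> (p \<otimes> x [^] m))"
    using c x up by (simp add: m_assoc)
  also have "\<dots> = x [^] n \<otimes> u \<otimes> (x \<otimes> x [^] m) \<otimes> q"
    using c x q by (simp add: m_assoc)
  also have "\<dots> = (u' \<otimes> x [^] (n + Suc m) \<otimes> v) \<otimes> q"
    using u' xm by simp
  also have "\<dots> = u' \<otimes> x [^] (Suc n + m) \<otimes> (v \<otimes> q)"
    using c x by (simp add: m_assoc del: nat_pow_Suc)
  finally show ?case
    using u' q P subgroup.m_closed[OF U] by blast
qed

text \<open>In the product of \<open>y [^] k\<close> and \<open>y\<close> the inner factor
  \<open>v \<otimes> a\<close> lies in \<open>U\<close>, so the preceding lemma merges the two
  powers of \<open>x\<close> around it.\<close>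

lemma double_coset_pow:
  assumes U: "subgroup U G" and x: "x \<in> carrier G" and P: "P \<subseteq> U"
    and Px: "\<And>p. p \<in> P \<Longrightarrow> inv x \<otimes> p \<otimes> x \<in> P"
    and fact: "\<And>g. g \<in> U \<Longrightarrow> \<exists>u\<in>U. \<exists>p\<in>P. x \<otimes> g = u \<otimes> x \<otimes> p"
    and y: "y = a \<otimes> x [^] n \<otimes> b" "a \<in> U" "b \<in> U"
  shows "\<exists>u\<in>U. \<exists>v\<in>U. y [^] (k::nat) = u \<otimes> x [^] (k * n) \<otimes> v"
proof (induction k)
  case 0
  then show ?case using subgroup.one_closed[OF U] by (intro bexI[of _ "\<one>"]) auto
next
  case (Suc k)
  have Uc: "U \<subseteq> carrier G" by (rule subgroup.subset[OF U])
  obtain u v where uv: "u \<in> U" "v \<in> U" "y [^] k = u \<otimes> x [^] (k * n) \<otimes> v" using Suc by blast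
  have "v \<otimes> a \<in> U" using uv y subgroup.m_closed[OF U] by blast
  from double_coset_mult_subset[OF U x P Px fact this]
  obtain s t where st: "s \<in> U" "t \<in> U"
    "x [^] (k * n) \<otimes> (v \<otimes> a) \<otimes> x [^] n = s \<otimes> x [^] (k * n + n) \<otimes> t" by blast
  have c: "u \<in> carrier G" "v \<in> carrier G" "a \<in> carrier G" "b \<in> carrier G" "s \<in> carrier G" "t \<in> carrier G"
    using uv y st Uc by auto
  have "y [^] Suc k = u \<otimes> (x [^] (k * n) \<otimes> (v \<otimes> a) \<otimes> x [^] n) \<otimes> b"
    using uv(3) c x by (simp add: m_assoc y(1))
  also have "\<dots> = (u \<otimes> s) \<otimes> x [^] (Suc k * n) \<otimes> (t \<otimes> b)"
    unfolding st(3) using c x by (simp add: m_assoc add.commute)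
  finally show ?case
    using uv y st subgroup.m_closed[OF U] by blast
qed

end

section \<open>Compact open subgroups and tidiness above\<close>

context tdlc_group
begin

text \<open>The unit is a compact connected component, so a clopen set \<open>A\<close> separates it
  inside the interior part \<open>W\<close> of a compact neighbourhood \<open>K\<close>; being
  closed in \<open>K\<close>, this \<open>A\<close> is compact.\<close>

lemma exists_compact_open_nhd:
  obtains C where "compactin T C" "openin T C" "\<one> \<in> C"
proof -
  have one: "\<one> \<in> topspace T" by (simp add: topspace_eq_carrier)
  obtain W K where W: "openin T W" "compactin T K" "\<one> \<in> W" "W \<subseteq> K"
    using locally_compact one unfolding locally_compact_space_def by meson
  have "{\<one>} \<in> connected_components_of T"
    using totally_disconnected one unfolding totally_disconnected_space_def connected_components_of_def
    by (metis imageI)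
  moreover have "compactin T {\<one>}" using one by simp
  ultimately obtain A B where AB: "openin T A" "openin T B" "disjnt A B" "A \<union> B = topspace T"
      "{\<one>} \<subseteq> A" "A \<subseteq> W"
    using wilder_locally_compact_component_thm[OF locally_compact Hausdorff _ _ W(1), of "{\<one>}"] W(3)
    by (metis empty_subsetI insert_subset)
  have "A = topspace T - B" using AB openin_subset by (fastforce simp: disjnt_iff)
  then have "closedin T A" using AB by blast
  then have "compactin T A" using closed_compactin[OF W(2)] AB W by blast
  then show thesis using that AB by blast
qed

text \<open>Existence part of van Dantzig's theorem. The subgroup is the stabiliser of a compact
  open \<open>C\<close> under right multiplication: it lies in \<open>C\<close> because the unit
  does, it is open by the tube lemma, and it is closed as an intersection of preimages of
  \<open>C\<close>.\<close>

lemma exists_compact_open_subgroup: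
  obtains V where "subgroup V G" "compactin T V" "openin T V"
proof -
  obtain C where C: "compactin T C" "openin T C" "\<one> \<in> C"
    by (rule exists_compact_open_nhd)
  have Cc: "C \<subseteq> carrier G" using C openin_subset topspace_eq_carrier by blast
  define V where "V = {g \<in> carrier G. (\<forall>c\<in>C. c \<otimes> g \<in> C) \<and> (\<forall>c\<in>C. c \<otimes> inv g \<in> C)}"
  have V: "subgroup V G"
  proof (rule subgroupI)
    show "V \<subseteq> carrier G" by (auto simp: V_def)
    show "V \<noteq> {}" using Cc by (auto simp: V_def intro!: exI[of _ "\<one>"])
    show "inv a \<in> V" if "a \<in> V" for a using that by (auto simp: V_def)
    show "a \<otimes> b \<in> V" if "a \<in> V" "b \<in> V" for a b
      using that Cc by (auto simp: V_def inv_mult_group subset_iff simp flip: m_assoc)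
  qed
  have VC: "V \<subseteq> C" using C(3) by (force simp: V_def)
  let ?W = "{z \<in> topspace (prod_topology T T). (\<lambda>(x, y). x \<otimes> y) z \<in> C}"
  have W: "openin (prod_topology T T) ?W"
    by (rule openin_continuous_map_preimage[OF continuous_mult C(2)])
  have sub: "C \<times> {\<one>} \<subseteq> ?W" using Cc by (auto simp: topspace_eq_carrier)
  \<comment> \<open>Compactness of \<open>C\<close> provides a single neighbourhood \<open>N\<close>
    of the unit that works for all \<open>c\<close> in \<open>C\<close> at once.\<close>
  obtain A N where AN: "openin T A" "openin T N" "C \<subseteq> A" "\<one> \<in> N" "A \<times> N \<subseteq> ?W"
    using tube_lemma_left[OF W C(1) _ sub] by (auto simp: topspace_eq_carrier)
  have CN: "c \<otimes> g \<in> C" if "c \<in> C" "g \<in> N" for c g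
  proof -
    have "(c, g) \<in> ?W" using AN that by blast
    then show ?thesis by simp
  qed
  \<comment> \<open>Symmetrised, so that both conditions in the definition of \<open>V\<close> hold
    on it.\<close>
  define N' where "N' = N \<inter> {g \<in> topspace T. inv g \<in> N}"
  have N': "openin T N'" unfolding N'_def
    by (intro openin_Int AN openin_continuous_map_preimage[OF continuous_inv])
  have N'V: "N' \<subseteq> V" using CN by (auto simp: N'_def V_def topspace_eq_carrier)
  have Vopen: "openin T V"
  proof (subst openin_subopen, intro ballI)
    fix v assume v: "v \<in> V"
    then have vc: "v \<in> carrier G" by (auto simp: V_def)
    \<comment> \<open>This is the translate \<open>v N'\<close>, an open neighbourhood of
      \<open>v\<close> that stays in the subgroup \<open>V\<close>.\<close>
    let ?O = "{y \<in> topspace T. inv v \<otimes> y \<otimes> \<one> \<in> N'}"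
    have "openin T ?O"
      by (rule openin_continuous_map_preimage[OF continuous_map_translations N']) (use vc in auto)
    moreover have "v \<in> ?O" using vc AN by (auto simp: N'_def topspace_eq_carrier)
    moreover have "?O \<subseteq> V"
    proof
      fix y assume y: "y \<in> ?O"
      then have yc: "y \<in> carrier G" by (auto simp: topspace_eq_carrier)
      have "inv v \<otimes> y \<in> V" using y N'V vc yc by auto
      then have "v \<otimes> (inv v \<otimes> y) \<in> V" using v subgroup.m_closed[OF V] by blast
      then show "y \<in> V" using vc yc by (simp flip: m_assoc)
    qed
    ultimately show "\<exists>U. openin T U \<and> v \<in> U \<and> U \<subseteq> V" by blast
  qed
  have "V = (\<Inter>c\<in>C. {g \<in> topspace T. c \<otimes> g \<otimes> \<one> \<in> C} \<inter> {g \<in> topspace T. c \<otimes> inv g \<in> C})"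
  proof (intro equalityI subsetI)
    fix g assume "g \<in> V"
    then show "g \<in> (\<Inter>c\<in>C. {g \<in> topspace T. c \<otimes> g \<otimes> \<one> \<in> C} \<inter> {g \<in> topspace T. c \<otimes> inv g \<in> C})"
      using Cc by (auto simp: V_def topspace_eq_carrier subset_iff)
  next
    fix g assume g: "g \<in> (\<Inter>c\<in>C. {g \<in> topspace T. c \<otimes> g \<otimes> \<one> \<in> C} \<inter> {g \<in> topspace T. c \<otimes> inv g \<in> C})"
    then have "g \<in> carrier G" using C(3) by (auto simp: topspace_eq_carrier)
    moreover from this have "c \<otimes> g \<in> C" "c \<otimes> inv g \<in> C" if "c \<in> C" for c
      using g that Cc r_one[of "c \<otimes> g"] by force+
    ultimately show "g \<in> V" by (simp add: V_def)
  qed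
  moreover have "closedin T \<dots>"
  proof (intro closedin_INT closedin_Int)
    have "closedin T C" using C(1) Hausdorff compactin_imp_closedin by blast
    then have "closedin T {g \<in> topspace T. f g \<in> C}" if "continuous_map T T f" for f
      using that closedin_continuous_map_preimage by blast
    moreover fix c assume "c \<in> C"
    ultimately show "closedin T {g \<in> topspace T. c \<otimes> g \<otimes> \<one> \<in> C}" "closedin T {g \<in> topspace T. c \<otimes> inv g \<in> C}"
      using Cc continuous_map_translations[of c "\<one>"]
        continuous_map_group_mult[OF _ continuous_inv, of "\<lambda>_. c"]
      by (auto simp: topspace_eq_carrier subset_iff)
  qed (use C in auto)
  ultimately have "closedin T V" by simp
  then have "compactin T V" using closed_compactin[OF C(1) VC] by blast
  then show thesis using that V Vopen by blast
qed

text \<open>A one-sided form of Willis's tidiness above: \<^term>\<open>P\<close> plays the role of the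
  subgroup $U_+$ in a factorisation $U = U_+ U_-$.\<close>

lemma exists_tidy_above_subgroup:
  assumes x: "x \<in> carrier G"
  obtains U P where "subgroup U G" "compactin T U" "openin T U" "P \<subseteq> U"
    "\<And>p. p \<in> P \<Longrightarrow> inv x \<otimes> p \<otimes> x \<in> P"
    "\<And>g. g \<in> U \<Longrightarrow> \<exists>u\<in>U. \<exists>p\<in>P. x \<otimes> g = u \<otimes> x \<otimes> p"
proof -
  obtain V where V: "subgroup V G" "compactin T V" "openin T V"
    by (rule exists_compact_open_subgroup)
  have Vclosed: "closedin T V" using V Hausdorff compactin_imp_closedin by blast
  \<comment> \<open>Conjugation by the inverse of \<open>x [^] k\<close>. Thus \<open>U n\<close>
    below is the intersection of the conjugates \<open>x^k V x^(-k)\<close> for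
    \<open>k \<le> n\<close>, and \<open>P\<close> is the intersection over all natural
    \<open>k\<close>.\<close>
  define c where "c k g = inv (x [^] k) \<otimes> g \<otimes> x [^] k" for k :: nat and g
  have c_mult: "c k (g \<otimes> h) = c k g \<otimes> c k h" if "g \<in> carrier G" "h \<in> carrier G" for k g h
  proof -
    have "x [^] k \<otimes> (inv (x [^] k) \<otimes> (h \<otimes> x [^] k)) = h \<otimes> x [^] k"
      using that x by (simp flip: m_assoc)
    then show ?thesis using that x by (simp add: c_def m_assoc)
  qed
  have c_inv: "c k (inv g) = inv (c k g)" if "g \<in> carrier G" for k g
    using that x by (simp add: c_def inv_mult_group m_assoc)
  have c_Suc: "c (Suc k) g = c k (inv x \<otimes> g \<otimes> x)" if "g \<in> carrier G" for k g
    using that x unfolding c_def nat_pow_Suc2[OF x] by (simp add: inv_mult_group m_assoc)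
  have c_0: "c 0 g = g" if "g \<in> carrier G" for g using that by (simp add: c_def)
  have c_cont: "continuous_map T T (c k)" for k
    unfolding c_def using x by (intro continuous_map_translations) auto
  define U where "U n = {g \<in> carrier G. \<forall>k\<le>n. c k g \<in> V}" for n
  define P where "P = (\<Inter>n. U n)"
  have U_eq: "U n = (\<Inter>k\<in>{..n}. {g \<in> topspace T. c k g \<in> V})" for n
    by (auto simp: U_def topspace_eq_carrier)
  have U_sub: "subgroup (U n) G" for n
  proof (rule subgroupI)
    show "U n \<subseteq> carrier G" by (auto simp: U_def)
    show "U n \<noteq> {}" using x subgroup.one_closed[OF V(1)] by (auto simp: U_def c_def intro!: exI[of _ "\<one>"])
    show "inv a \<in> U n" if "a \<in> U n" for a
      using that subgroup.m_inv_closed[OF V(1)] by (auto simp: U_def c_inv)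
    show "a \<otimes> b \<in> U n" if "a \<in> U n" "b \<in> U n" for a b
      using that subgroup.m_closed[OF V(1)] by (auto simp: U_def c_mult)
  qed
  have U_open: "openin T (U n)" for n
    unfolding U_eq using V(3) c_cont by (intro openin_INT2) (auto intro!: openin_continuous_map_preimage)
  have U_closed: "closedin T (U n)" for n
    unfolding U_eq using Vclosed c_cont by (intro closedin_INT) (auto intro!: closedin_continuous_map_preimage)
  have U_V: "U n \<subseteq> V" for n using c_0 by (force simp: U_def)
  have U_compact: "compactin T (U n)" for n
    using closed_compactin[OF V(2) U_V U_closed] .
  have U_dec: "decseq U" by (force simp: decseq_def U_def)
  \<comment> \<open>\<open>W\<close> is the conjugate \<open>x^(-1) V x\<close>, and
    \<open>WP\<close> is the product set \<open>W P\<close>: an open set that contains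
    \<open>P\<close> because \<open>W\<close> contains the unit.\<close>
  define W where "W = {g \<in> carrier G. x \<otimes> g \<otimes> inv x \<in> V}"
  have W_open: "openin T W"
    using openin_continuous_map_preimage[OF continuous_map_translations[of x "inv x"] V(3)] x
    by (simp add: W_def topspace_eq_carrier)
  define WP where "WP = (\<Union>p\<in>P. {g \<in> topspace T. \<one> \<otimes> g \<otimes> inv p \<in> W})"
  have Pc: "P \<subseteq> carrier G" by (auto simp: P_def U_def)
  have WP_open: "openin T WP"
    unfolding WP_def
    by (rule openin_Union)
      (use Pc in \<open>auto intro!: openin_continuous_map_preimage[OF continuous_map_translations W_open]\<close>)
  have P_WP: "P \<subseteq> WP"
  proof
    fix p assume p: "p \<in> P"
    then have "p \<otimes> inv p \<in> W"
      using Pc x subgroup.one_closed[OF V(1)] by (auto simp: W_def)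
    then have "\<one> \<otimes> p \<otimes> inv p \<in> W" using p Pc by auto
    then show "p \<in> WP" using p Pc by (auto simp: WP_def topspace_eq_carrier)
  qed
  \<comment> \<open>The sets \<open>U n - WP\<close> are closed and decreasing in the compact
    \<open>V\<close>, and their intersection \<open>P - WP\<close> is empty, so one of them is
    already empty.\<close>
  have "\<exists>n. U n \<subseteq> WP"
  proof (rule ccontr)
    assume no: "\<nexists>n. U n \<subseteq> WP"
    have "(\<Inter>n. U n - WP) \<noteq> {}"
    proof (rule compact_space_imp_nest)
      show "compact_space (subtopology T V)" using V(2) by (simp add: compact_space_subtopology)
      show "closedin (subtopology T V) (U n - WP)" for n
        using U_closed WP_open U_V by (intro closedin_subset_topspace closedin_diff) auto
      show "U n - WP \<noteq> {}" for n using no by auto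
      show "decseq (\<lambda>n. U n - WP)" using U_dec by (force simp: decseq_def)
    qed
    then show False using P_WP by (auto simp: P_def)
  qed
  then obtain n where n: "U n \<subseteq> WP" by blast
  have P_U: "P \<subseteq> U n" by (auto simp: P_def)
  have P_iff: "g \<in> P \<longleftrightarrow> g \<in> carrier G \<and> (\<forall>k. c k g \<in> V)" for g
    by (auto simp: P_def U_def)
  show thesis
  proof (rule that[OF U_sub U_compact U_open P_U])
    show "inv x \<otimes> p \<otimes> x \<in> P" if "p \<in> P" for p
      using that x by (auto simp: P_iff simp flip: c_Suc)
    fix g assume g: "g \<in> U n"
    then obtain p where p: "p \<in> P" "g \<otimes> inv p \<in> W"
      using n Pc by (auto simp: WP_def topspace_eq_carrier subset_iff)
    have car: "g \<in> carrier G" "p \<in> carrier G" using g p Pc by (auto simp: U_def)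
    \<comment> \<open>Now \<open>g\<close> is \<open>h \<otimes> p\<close> with \<open>h\<close> in
      both \<open>W\<close> and \<open>U n\<close>. The conjugate of \<open>h\<close> by
      \<open>x\<close> is again in \<open>U n\<close>: the condition at \<open>k = 0\<close> says
      that \<open>h\<close> lies in \<open>W\<close>, and the condition at \<open>Suc j\<close> is
      the one at \<open>j\<close> for \<open>h\<close>.\<close>
    define h where "h = g \<otimes> inv p"
    have h: "h \<in> U n" unfolding h_def
      using g p P_U subgroup.m_closed[OF U_sub] subgroup.m_inv_closed[OF U_sub] by blast
    have hc: "h \<in> carrier G" using h by (auto simp: U_def)
    have "x \<otimes> h \<otimes> inv x \<in> U n"
    proof -
      have "c k (x \<otimes> h \<otimes> inv x) \<in> V" if "k \<le> n" for k
      proof (cases k)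
        case 0
        then show ?thesis using p x hc by (auto simp: W_def h_def c_0)
      next
        case (Suc j)
        have "x \<otimes> h \<otimes> inv x \<in> carrier G" using x hc by simp
        then have "c k (x \<otimes> h \<otimes> inv x) = c j (inv x \<otimes> (x \<otimes> h \<otimes> inv x) \<otimes> x)"
          unfolding Suc by (rule c_Suc)
        also have "inv x \<otimes> (x \<otimes> h \<otimes> inv x) \<otimes> x = h"
          using x hc by (metis inv_closed inv_solve_left inv_solve_right m_assoc m_closed)
        finally show ?thesis using h that Suc by (auto simp: U_def)
      qed
      then show ?thesis using x hc by (auto simp: U_def)
    qed
    moreover have "x \<otimes> g = (x \<otimes> h \<otimes> inv x) \<otimes> x \<otimes> p"
      using x car by (simp add: h_def m_assoc)
    ultimately show "\<exists>u\<in>U n. \<exists>p\<in>P. x \<otimes> g = u \<otimes> x \<otimes> p" using p by blast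
  qed
qed

section \<open>Precompact cyclic subgroups and trivial contraction\<close>

lemma precompact_generate_singleton:
  assumes x: "x \<in> carrier G" and U: "subgroup U G" "compactin T U"
    and n: "n > 0" "x [^] (n::nat) \<in> U"
  shows "precompact_in T (generate G {x})"
proof -
  define K where "K = (\<Union>i<n. (\<lambda>g. x [^] i \<otimes> g \<otimes> \<one>) ` U)"
  have "compactin T K" unfolding K_def
    using x by (intro compactin_Union) (auto intro!: image_compactin[OF U(2)] continuous_map_translations)
  have Uc: "U \<subseteq> carrier G" using U subgroup.subset by blast
  have "generate G {x} \<subseteq> K"
  proof
    fix g assume "g \<in> generate G {x}"
    then obtain k :: int where k: "g = x [^] k" using generate_pow[OF x] by blast
    \<comment> \<open>\<open>mod\<close> with a positive modulus is nonnegative even for negative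
      \<open>k\<close>, so the \<open>n\<close> translates in \<open>K\<close> also catch the
      negative powers of \<open>x\<close>.\<close>
    define i where "i = nat (k mod int n)"
    have i: "i < n" "k = int i + int n * (k div int n)"
      using n by (auto simp: i_def nat_less_iff)
    have "g = x [^] int i \<otimes> x [^] (int n * (k div int n))"
      using x i(2) by (metis k int_pow_mult)
    also have "x [^] (int n * (k div int n)) = (x [^] n) [^] (k div int n)"
      using x by (simp add: int_pow_pow flip: int_pow_int)
    finally have "g = x [^] i \<otimes> (x [^] n) [^] (k div int n)" by (simp add: int_pow_int)
    moreover have "(x [^] n) [^] (k div int n) \<in> U"
      using subgroup_int_pow_closed[OF U(1) n(2)] .
    ultimately show "g \<in> K" using i x Uc unfolding K_def by force
  qed
  moreover have "closedin T K"
    using \<open>compactin T K\<close> Hausdorff compactin_imp_closedin by blast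
  ultimately have "T closure_of generate G {x} \<subseteq> K" by (rule closure_of_minimal)
  then show ?thesis
    unfolding precompact_in_def using closed_compactin[OF \<open>compactin T K\<close>] by simp
qed

text \<open>The conjugates of \<open>g\<close> by the compact closure form a closed set
  \<open>S\<close>, which therefore contains the limit; only the unit has the unit as a
  conjugate.\<close>

lemma con_eq_one_if_precompact:
  assumes x: "x \<in> carrier G" and pre: "precompact_in T (generate G {x})"
  shows "con G T x = {\<one>}"
proof (intro equalityI subsetI)
  fix g assume "g \<in> {\<one>}"
  then show "g \<in> con G T x"
    using x by (auto simp: con_def int_pow_neg int_pow_int limitin_const_iff topspace_eq_carrier)
next
  fix g assume g: "g \<in> con G T x"
  then have gc: "g \<in> carrier G"
    and lim: "limitin T (\<lambda>n::nat. x [^] n \<otimes> g \<otimes> x [^] (- int n)) \<one> sequentially"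
    by (auto simp: con_def)
  define K where "K = T closure_of generate G {x}"
  have K: "compactin T K" using pre by (simp add: K_def precompact_in_def)
  have Kc: "K \<subseteq> carrier G" using closure_of_subset_topspace topspace_eq_carrier by (force simp: K_def)
  have genK: "generate G {x} \<subseteq> K" unfolding K_def
    using generate_in_carrier[of "{x}"] x by (intro closure_of_subset) (auto simp: topspace_eq_carrier)
  define S where "S = (\<lambda>k. k \<otimes> g \<otimes> inv k) ` K"
  have "compactin T S" unfolding S_def
    using gc by (intro image_compactin[OF K] continuous_map_group_mult continuous_inv)
      (auto simp: topspace_eq_carrier)
  then have S: "closedin T S" using Hausdorff compactin_imp_closedin by blast
  have "x [^] n \<otimes> g \<otimes> x [^] (- int n) \<in> S" for n :: nat
  proof -
    have "x [^] int n \<in> K" using genK generate_pow[OF x] by blast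
    then show ?thesis using x by (auto simp: S_def int_pow_neg int_pow_int)
  qed
  then have "\<one> \<in> S"
    using limitin_closedin[OF lim S] by simp
  then obtain k where k: "k \<in> carrier G" "k \<otimes> g \<otimes> inv k = \<one>" using Kc by (auto simp: S_def)
  then show "g \<in> {\<one>}"
    using gc by (metis inv_closed inv_inv inv_solve_right' l_cancel_one one_closed m_closed l_one singletonI)
qed

end

section \<open>Recurrence combined with finite order in \<open>H\<close>\<close>

theorem proposition2p7:
  fixes G :: "('a, 'm) monoid_scheme" and T :: "'a topology" and H :: "'a set"
  assumes "tdlc_group G T"
    and "lattice_subgroup G T H"
    and "\<And>h. h \<in> H \<Longrightarrow> finite (generate G {h})"
  shows "anisotropic G T \<and> (\<forall>x \<in> carrier G. precompact_in T (generate G {x}))"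
proof -
  interpret tdlc_group G T by fact
  have H: "subgroup H G" "finite_covolume G T H"
    using assms(2) by (auto simp: lattice_subgroup_def)
  have pre: "precompact_in T (generate G {x})" if x: "x \<in> carrier G" for x
  proof -
    obtain U P where U: "subgroup U G" "compactin T U" "openin T U" and P: "P \<subseteq> U"
      "\<And>p. p \<in> P \<Longrightarrow> inv\<^bsub>G\<^esub> x \<otimes>\<^bsub>G\<^esub> p \<otimes>\<^bsub>G\<^esub> x \<in> P"
      "\<And>g. g \<in> U \<Longrightarrow> \<exists>u\<in>U. \<exists>p\<in>P. x \<otimes>\<^bsub>G\<^esub> g = u \<otimes>\<^bsub>G\<^esub> x \<otimes>\<^bsub>G\<^esub> p"
      using exists_tidy_above_subgroup[OF x] by metis
    have ne: "U \<noteq> {}" using subgroup.one_closed[OF U(1)] by blast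
    obtain n :: nat and u v where n: "n > 0" and uv: "u \<in> U" "v \<in> U"
      and h: "inv\<^bsub>G\<^esub> u \<otimes>\<^bsub>G\<^esub> x [^]\<^bsub>G\<^esub> n \<otimes>\<^bsub>G\<^esub> v \<in> H"
      using finite_covolume_recurrence[OF H U(3) ne x] by metis
    \<comment> \<open>This element lies in \<open>H\<close>, hence has finite order, and also in the
      double coset of \<open>x [^] n\<close>.\<close>
    define y where "y = inv\<^bsub>G\<^esub> u \<otimes>\<^bsub>G\<^esub> x [^]\<^bsub>G\<^esub> n \<otimes>\<^bsub>G\<^esub> v"
    have yc: "y \<in> carrier G" using h subgroup.subset[OF H(1)] by (auto simp: y_def)
    \<comment> \<open>\<open>ord y\<close> is the cardinality of the generated subgroup;
      \<open>card\<close> is 0 on empty and on infinite sets, so both cases must be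
      excluded.\<close>
    have "generate G {y} \<noteq> {}" using generate.one by fastforce
    then have k: "ord y > 0"
      using assms(3)[OF h] generate_pow_card[OF yc] by (simp add: y_def card_gt_0_iff)
    obtain s t where st: "s \<in> U" "t \<in> U" "y [^]\<^bsub>G\<^esub> ord y = s \<otimes>\<^bsub>G\<^esub> x [^]\<^bsub>G\<^esub> (ord y * n) \<otimes>\<^bsub>G\<^esub> t"
      using double_coset_pow[OF U(1) x P y_def subgroup.m_inv_closed[OF U(1) uv(1)] uv(2)] by blast
    have stc: "s \<in> carrier G" "t \<in> carrier G" using st subgroup.subset[OF U(1)] by auto
    \<comment> \<open>Raising \<open>y\<close> to its order puts the unit into the double coset of a
      positive power of \<open>x\<close>, and solving for that power places it in
      \<open>U\<close>.\<close>
    have "s \<otimes>\<^bsub>G\<^esub> x [^]\<^bsub>G\<^esub> (ord y * n) \<otimes>\<^bsub>G\<^esub> t = \<one>\<^bsub>G\<^esub>"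
      using st(3) pow_ord_eq_1[OF yc] by simp
    then have "x [^]\<^bsub>G\<^esub> (ord y * n) = inv\<^bsub>G\<^esub> s \<otimes>\<^bsub>G\<^esub> inv\<^bsub>G\<^esub> t"
      using x stc by (metis inv_closed inv_equality inv_solve_left m_closed nat_pow_closed)
    then have "x [^]\<^bsub>G\<^esub> (ord y * n) \<in> U"
      using st subgroup.m_closed[OF U(1)] subgroup.m_inv_closed[OF U(1)] by simp
    then show ?thesis
      using precompact_generate_singleton[OF x U(1,2)] k n by (meson nat_0_less_mult_iff)
  qed
  then show ?thesis
    using con_eq_one_if_precompact by (auto simp: anisotropic_def)
qed

end
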